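(* Let $(X_t)_{t\ge1}$ be random vectors in $\mathbb{R}^d$ with conditional means $\mu_t=\mathbb{E}[X_t\mid\mathcal{F}_{t-1}]$ (possibly changing with $t$), and suppose $(X_t)$ is conditionally $\sigma_t$-sub-Gaussian. Set $H_t=\sum_{i\leq t}\sigma_i^2$. Then, for any $a>0$, $\epsilon\in(0,1)$ and $\alpha\in(0,1)$, with probability at least $1-\alpha$, simultaneously for all $t\geq 1$, $$\left\|\frac{1}{t}\sum_{i\leq t}(X_i-\mu_i)\right\|\leq\frac{1}{1-\epsilon}\sqrt{\frac{2(1+a^2H_t)}{a^2t^2}\left(d\log(1/\epsilon)+\log\Big(\frac{\sqrt{1+a^2H_t}}{\alpha}\Big)\right)}.$$
   Context: $\mathcal{F}_t=\sigma(X_1,\dots,X_t)$ ($\mathcal{F}_0$ trivial). $\|\cdot\|$ is the Euclidean norm. $(X_t)$ is conditionally $\sigma_t$-sub-Gaussian if, for every $t$, $\sigma_t\ge0$ is an $\mathcal{F}_t$-measurable scalar and $$\mathbb{E}\big[\exp\{\lambda\langle\theta,X_t-\mu_t\rangle-\tfrac{\lambda^2}{2}\sigma_t^2\|\theta\|^2\}\mid\mathcal{F}_{t-1}\big]\le 1\quad\text{for all }\theta\in\mathbb{R}^d,\ \lambda\in\mathbb{R}.$$ *)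

theory Defs
  imports "HOL-Probability.Probability"
begin

text \<open>
  The time index of a process starts at 1; the values at index 0 play no role.
  For \<open>t = 0\<close> the generating family below is empty, so the \<sigma>-algebra is trivial.
\<close>

definition natural_filtration ::
    "'w measure \<Rightarrow> (nat \<Rightarrow> 'w \<Rightarrow> 'a::topological_space) \<Rightarrow> nat \<Rightarrow> 'w measure" where
  "natural_filtration M X t =
     sigma (space M) {X i -` A \<inter> space M | i A. i \<in> {1..t} \<and> A \<in> sets borel}"

text \<open>The library only has scalar conditional expectations, so take them coordinatewise.\<close>

definition vec_cond_exp ::
    "'w measure \<Rightarrow> 'w measure \<Rightarrow> ('w \<Rightarrow> 'a::euclidean_space) \<Rightarrow> 'w \<Rightarrow> 'a" where
  "vec_cond_exp M F Y \<omega> = (\<Sum>b\<in>Basis. real_cond_exp M F (\<lambda>w. Y w \<bullet> b) \<omega> *\<^sub>R b)"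

text \<open>Conditional means are determined only up to null sets: \<open>\<mu> t\<close> may be any version.\<close>

definition conditional_means ::
    "'w measure \<Rightarrow> (nat \<Rightarrow> 'w \<Rightarrow> 'a::euclidean_space) \<Rightarrow> (nat \<Rightarrow> 'w \<Rightarrow> 'a) \<Rightarrow> bool" where
  "conditional_means M X \<mu> \<longleftrightarrow>
     (\<forall>t\<ge>1. \<mu> t \<in> borel_measurable (natural_filtration M X (t - 1)) \<and>
        (AE \<omega> in M. \<mu> t \<omega> = vec_cond_exp M (natural_filtration M X (t - 1)) (X t) \<omega>))"

text \<open>
  The conditional expectation of the exponential is taken in \<open>[0, \<infinity>]\<close>: \<^const>\<open>real_cond_exp\<close>
  maps infinite values to 0, which would make the bound hold vacuously where the
  conditional expectation is infinite.
\<close>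

definition conditionally_sub_gaussian ::
    "'w measure \<Rightarrow> (nat \<Rightarrow> 'w \<Rightarrow> 'a::euclidean_space) \<Rightarrow> (nat \<Rightarrow> 'w \<Rightarrow> 'a) \<Rightarrow>
       (nat \<Rightarrow> 'w \<Rightarrow> real) \<Rightarrow> bool" where
  "conditionally_sub_gaussian M X \<mu> \<sigma> \<longleftrightarrow>
     (\<forall>t\<ge>1.
        \<sigma> t \<in> borel_measurable (natural_filtration M X t) \<and>
        (\<forall>\<omega>\<in>space M. 0 \<le> \<sigma> t \<omega>) \<and>
        (\<forall>\<theta> l. AE \<omega> in M.
           nn_cond_exp M (natural_filtration M X (t - 1))
             (\<lambda>w. ennreal (exp (l * (\<theta> \<bullet> (X t w - \<mu> t w)) - l\<^sup>2 / 2 * (\<sigma> t w)\<^sup>2 * (norm \<theta>)\<^sup>2))) \<omega> \<le> 1))"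

lemma space_natural_filtration [simp]: "space (natural_filtration M X t) = space M"
  unfolding natural_filtration_def by (rule space_measure_of) auto

lemma sets_natural_filtration:
  "sets (natural_filtration M X t) =
     sigma_sets (space M) {X i -` A \<inter> space M | i A. i \<in> {1..t} \<and> A \<in> sets borel}"
  unfolding natural_filtration_def by (rule sets_measure_of) auto

lemma subalgebra_natural_filtration:
  assumes "\<And>i. i \<ge> 1 \<Longrightarrow> X i \<in> borel_measurable M"
  shows "subalgebra M (natural_filtration M X t)"
  unfolding subalgebra_def sets_natural_filtration
  using assms by (auto intro!: sets.sigma_sets_subset measurable_sets)

end

theory Submission
  imports Defs
begin

text \<open>
  With \<open>S\<^sub>t = \<Sum>\<^sub>i\<^sub>\<le>\<^sub>t (X\<^sub>i - \<mu>\<^sub>i)\<close>, average the supermartingales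
  \<open>exp (l \<langle>\<theta>, S\<^sub>t\<rangle> - l\<^sup>2/2 H\<^sub>t \<parallel>\<theta>\<parallel>\<^sup>2)\<close> over \<open>\<theta>\<close> uniform in the unit ball and an
  independent \<open>l\<close> that is normal with variance \<open>a\<^sup>2\<close>. By Ville's inequality the mixture stays
  below \<open>1/\<alpha>\<close> for all \<open>t\<close> with probability at least \<open>1 - \<alpha>\<close>. From below, keep only the \<open>\<theta>\<close> in the
  ball of radius \<open>\<epsilon>\<close> about \<open>(1 - \<epsilon>) S\<^sub>t / \<parallel>S\<^sub>t\<parallel>\<close>: it lies in the unit ball and carries mass
  \<open>\<epsilon>\<^sup>d\<close>, and by convexity the average of \<open>exp (l \<langle>\<theta>, S\<^sub>t\<rangle>)\<close> over it is at least
  \<open>exp (l (1 - \<epsilon>) \<parallel>S\<^sub>t\<parallel>)\<close>. The Gaussian integral in \<open>l\<close> then gives the quadratic exponent.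
\<close>

section \<open>Maximal inequality for nonnegative supermartingales\<close>

text \<open>Keeping \<open>W n\<close> until level \<open>c\<close> is first reached, and exactly
  \<open>c\<close> from then on, never raises the expected total. The supermartingale property is
  stated through integrals over events of \<open>F n\<close>: this form allows infinite values and
  passes to mixtures by Tonelli.\<close>

lemma ville_inequality:
  fixes W :: "nat \<Rightarrow> 'w \<Rightarrow> ennreal"
  assumes sub: "\<And>n. subalgebra M (F n)"
    and mono: "\<And>n. sets (F n) \<subseteq> sets (F (Suc n))"
    and W: "\<And>n. W n \<in> borel_measurable (F n)"
    and super: "\<And>n A. A \<in> sets (F n) \<Longrightarrow>
      (\<integral>\<^sup>+\<omega>. W (Suc n) \<omega> * indicator A \<omega> \<partial>M) \<le> (\<integral>\<^sup>+\<omega>. W n \<omega> * indicator A \<omega> \<partial>M)"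
  shows "c * emeasure M {\<omega> \<in> space M. \<exists>n. c \<le> W n \<omega>} \<le> (\<integral>\<^sup>+\<omega>. W 0 \<omega> \<partial>M)"
proof -
  define A where "A n = {\<omega> \<in> space M. \<exists>k\<le>n. c \<le> W k \<omega>}" for n
  have space: "space (F n) = space M" for n
    using sub[of n] by (simp add: subalgebra_def)
  have le: "sets (F k) \<subseteq> sets (F n)" if "k \<le> n" for k n
    using lift_Suc_mono_le[of "\<lambda>n. sets (F n)"] mono that by blast
  have WM[measurable]: "W n \<in> borel_measurable M" for n
    using W sub measurable_from_subalg by blast
  have AF: "A n \<in> sets (F n)" for n
  proof -
    have "{\<omega> \<in> space (F k). c \<le> W k \<omega>} \<in> sets (F k)" for k
      using W[of k] by measurable
    then have "{\<omega> \<in> space M. c \<le> W k \<omega>} \<in> sets (F n)" if "k \<le> n" for k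
      using le[OF that] unfolding space by blast
    then have "(\<Union>k\<in>{..n}. {\<omega> \<in> space M. c \<le> W k \<omega>}) \<in> sets (F n)"
      by (intro sets.finite_UN) auto
    also have "(\<Union>k\<in>{..n}. {\<omega> \<in> space M. c \<le> W k \<omega>}) = A n"
      by (auto simp: A_def)
    finally show ?thesis .
  qed
  have AM[measurable]: "A n \<in> sets M" for n
    using AF[of n] sub[of n] by (auto simp: subalgebra_def)
  have Asub: "A n \<subseteq> A (Suc n)" for n
    unfolding A_def using le_SucI by blast
  \<comment> \<open>The induction tracks the process stopped on reaching level \<open>c\<close>, so no stopping times are needed.\<close>
  have ind: "c * emeasure M (A n) + (\<integral>\<^sup>+\<omega>. W n \<omega> * indicator (space M - A n) \<omega> \<partial>M)
      \<le> (\<integral>\<^sup>+\<omega>. W 0 \<omega> \<partial>M)" for n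
  proof (induction n)
    case 0
    have "c * emeasure M (A 0) = (\<integral>\<^sup>+\<omega>. c * indicator (A 0) \<omega> \<partial>M)"
      by (rule nn_integral_cmult_indicator[symmetric]) simp
    then have "c * emeasure M (A 0) + (\<integral>\<^sup>+\<omega>. W 0 \<omega> * indicator (space M - A 0) \<omega> \<partial>M)
      = (\<integral>\<^sup>+\<omega>. c * indicator (A 0) \<omega> + W 0 \<omega> * indicator (space M - A 0) \<omega> \<partial>M)"
      by (simp add: nn_integral_add)
    also have "\<dots> \<le> (\<integral>\<^sup>+\<omega>. W 0 \<omega> \<partial>M)"
      by (intro nn_integral_mono) (auto simp: A_def split: split_indicator)
    finally show ?case .
  next
    case (Suc n)
    let ?B = "space M - A n"
    have B: "?B \<in> sets (F n)"
      using AF[of n] space sets.compl_sets by metis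
    have "c * emeasure M (A (Suc n))
        = (\<integral>\<^sup>+\<omega>. c * indicator (A (Suc n)) \<omega> \<partial>M)"
      by (rule nn_integral_cmult_indicator[symmetric]) simp
    also have "\<dots> = (\<integral>\<^sup>+\<omega>. c * indicator (A n) \<omega> + c * indicator (A (Suc n) - A n) \<omega> \<partial>M)"
      using Asub[of n] by (intro nn_integral_cong) (auto split: split_indicator)
    also have "\<dots> = c * emeasure M (A n) + (\<integral>\<^sup>+\<omega>. c * indicator (A (Suc n) - A n) \<omega> \<partial>M)"
      by (subst nn_integral_add) (auto simp: nn_integral_cmult_indicator)
    finally have "c * emeasure M (A (Suc n)) + (\<integral>\<^sup>+\<omega>. W (Suc n) \<omega> * indicator (space M - A (Suc n)) \<omega> \<partial>M)
      = c * emeasure M (A n) + (\<integral>\<^sup>+\<omega>. c * indicator (A (Suc n) - A n) \<omega>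
            + W (Suc n) \<omega> * indicator (space M - A (Suc n)) \<omega> \<partial>M)"
      by (subst nn_integral_add) (auto simp: add.assoc)
    \<comment> \<open>On \<open>A (Suc n) - A n\<close> the level is first reached at time
      \<open>Suc n\<close>, so there \<open>W (Suc n)\<close> pays for \<open>c\<close>. What
      remains lives on \<open>?B\<close>, an event of \<open>F n\<close>, to which
      \<open>super\<close> applies.\<close>
    also have "\<dots> \<le> c * emeasure M (A n) + (\<integral>\<^sup>+\<omega>. W (Suc n) \<omega> * indicator ?B \<omega> \<partial>M)"
      using Asub[of n]
      by (intro add_left_mono nn_integral_mono)
         (auto simp: A_def le_Suc_eq split: split_indicator)
    also have "\<dots> \<le> c * emeasure M (A n) + (\<integral>\<^sup>+\<omega>. W n \<omega> * indicator ?B \<omega> \<partial>M)"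
      using super[OF B] by (rule add_left_mono)
    also have "\<dots> \<le> (\<integral>\<^sup>+\<omega>. W 0 \<omega> \<partial>M)"
      by (rule Suc.IH)
    finally show ?case .
  qed
  have "{\<omega> \<in> space M. \<exists>n. c \<le> W n \<omega>} = (\<Union>n. A n)"
    by (auto simp: A_def)
  then have "c * emeasure M {\<omega> \<in> space M. \<exists>n. c \<le> W n \<omega>} = (SUP n. c * emeasure M (A n))"
    using Asub by (simp add: SUP_emeasure_incseq[symmetric] incseq_SucI image_subset_iff SUP_mult_left_ennreal)
  also have "\<dots> \<le> (\<integral>\<^sup>+\<omega>. W 0 \<omega> \<partial>M)"
  proof (rule SUP_least)
    fix n
    show "c * emeasure M (A n) \<le> (\<integral>\<^sup>+\<omega>. W 0 \<omega> \<partial>M)"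
      by (rule order_trans[OF _ ind[of n]]) simp
  qed
  finally show ?thesis .
qed

section \<open>Exponential averages over balls\<close>

lemma nn_integral_lborel_reflect:
  fixes f :: "'a::euclidean_space \<Rightarrow> ennreal"
  assumes [measurable]: "f \<in> borel_measurable borel"
  shows "(\<integral>\<^sup>+x. f x \<partial>lborel) = (\<integral>\<^sup>+x. f (t - x) \<partial>lborel)"
  by (subst lborel_affine[of "-1" t]) (simp_all add: nn_integral_density nn_integral_distr)

text \<open>Jensen's inequality for the uniform law on a ball, whose barycentre is \<open>c\<close>.
  The unnormalised form also covers balls of zero volume.\<close>

lemma nn_integral_exp_inner_cball_ge:
  fixes c u :: "'a::euclidean_space"
  shows "ennreal (exp (u \<bullet> c)) * emeasure lborel (cball c r)
    \<le> (\<integral>\<^sup>+x. ennreal (exp (u \<bullet> x)) * indicator (cball c r) x \<partial>lborel)"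
    (is "?E * ?V \<le> ?I")
proof -
  let ?f = "\<lambda>x. ennreal (exp (u \<bullet> x)) * indicator (cball c r) x"
  have [measurable]: "cball c r \<in> sets borel"
    by (rule borel_closed) simp
  \<comment> \<open>Average over \<open>x\<close> and its mirror image \<open>2c - x\<close>, using \<open>e\<^sup>s + e\<^sup>t \<ge> 2 e\<^bsup>(s+t)/2\<^esup>\<close>.\<close>
  have ball: "c + c - x \<in> cball c r \<longleftrightarrow> x \<in> cball c r" for x
    by (simp add: dist_norm norm_minus_commute algebra_simps)
  have pt: "2 * exp (u \<bullet> c) \<le> exp (u \<bullet> x) + exp (u \<bullet> (c + c - x))" for x
  proof -
    have "0 \<le> (exp ((u \<bullet> x) / 2) - exp ((u \<bullet> (c + c - x)) / 2))\<^sup>2"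
      by simp
    also have "\<dots> = exp (u \<bullet> x) + exp (u \<bullet> (c + c - x)) - 2 * exp (u \<bullet> c)"
      by (simp add: power2_diff exp_double[symmetric] exp_add[symmetric] inner_diff_right
          inner_add_right add_divide_distrib diff_divide_distrib mult.assoc)
    finally show ?thesis by simp
  qed
  have pt': "2 * (?E * indicator (cball c r) x) \<le> ?f x + ?f (c + c - x)" for x
  proof (cases "x \<in> cball c r")
    case True
    then have "c + c - x \<in> cball c r" using ball by blast
    moreover have "2 * ?E = ennreal (2 * exp (u \<bullet> c))"
      by (simp add: ennreal_mult)
    ultimately show ?thesis
      using True ennreal_leI[OF pt[of x]] by (simp add: ennreal_plus[symmetric] del: ennreal_plus)
  qed simp
  have "2 * (?E * ?V) = (\<integral>\<^sup>+x. 2 * (?E * indicator (cball c r) x) \<partial>lborel)"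
    by (simp add: mult.assoc[symmetric] nn_integral_cmult_indicator)
  also have "\<dots> \<le> (\<integral>\<^sup>+x. ?f x + ?f (c + c - x) \<partial>lborel)"
    by (intro nn_integral_mono pt')
  also have "\<dots> = ?I + (\<integral>\<^sup>+x. ?f (c + c - x) \<partial>lborel)"
    by (intro nn_integral_add) measurable
  also have "(\<integral>\<^sup>+x. ?f (c + c - x) \<partial>lborel) = ?I"
    by (rule nn_integral_lborel_reflect[symmetric]) measurable
  finally have "2 * (?E * ?V) \<le> 2 * ?I"
    by (simp add: mult_2)
  then show ?thesis
    by (simp add: ennreal_mult_le_mult_iff)
qed

section \<open>Gaussian integral of a quadratic exponential\<close>

text \<open>Completing the square: with \<open>k = 1 + a\<^sup>2 * h\<close>, the integrand is a
  constant times the normal density of mean \<open>a\<^sup>2 * u / k\<close> and variance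
  \<open>a\<^sup>2 / k\<close>, and that constant is the integral.\<close>

lemma nn_integral_exp_quadratic_normal:
  assumes a: "a > 0" and h: "h \<ge> 0"
  shows "(\<integral>\<^sup>+l. ennreal (normal_density 0 a l) * ennreal (exp (l * u - l\<^sup>2 / 2 * h)) \<partial>lborel)
    = ennreal (exp (a\<^sup>2 * u\<^sup>2 / (2 * (1 + a\<^sup>2 * h))) / sqrt (1 + a\<^sup>2 * h))"
proof -
  define k where "k = 1 + a\<^sup>2 * h"
  have k: "k > 0" using h by (simp add: k_def add_pos_nonneg)
  define K where "K = exp (a\<^sup>2 * u\<^sup>2 / (2 * k)) / sqrt k"
  let ?d = "normal_density (a\<^sup>2 * u / k) (a / sqrt k)"
  have sq: "(a / sqrt k)\<^sup>2 = a\<^sup>2 / k" using k by (simp add: power_divide)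
  have pt: "normal_density 0 a l * exp (l * u - l\<^sup>2 / 2 * h) = K * ?d l" for l
  proof -
    have h': "h = (k - 1) / a\<^sup>2" using a by (simp add: k_def)
    have "- l\<^sup>2 / (2 * a\<^sup>2) + (l * u - l\<^sup>2 / 2 * h)
        = a\<^sup>2 * u\<^sup>2 / (2 * k) + - (l - a\<^sup>2 * u / k)\<^sup>2 / (2 * (a\<^sup>2 / k))"
      unfolding h' using a k by (simp add: field_simps power2_eq_square)
    then have e: "exp (- l\<^sup>2 / (2 * a\<^sup>2)) * exp (l * u - l\<^sup>2 / 2 * h)
        = exp (a\<^sup>2 * u\<^sup>2 / (2 * k)) * exp (- (l - a\<^sup>2 * u / k)\<^sup>2 / (2 * (a\<^sup>2 / k)))"
      by (simp only: exp_add[symmetric])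
    \<comment> \<open>Comparing the two normalising constants gives the factor
      \<open>1 / sqrt k\<close> in \<open>K\<close>.\<close>
    have r: "1 / sqrt (2 * pi * (a\<^sup>2 / k)) = sqrt k / sqrt (2 * pi * a\<^sup>2)"
      by (simp add: real_sqrt_divide real_sqrt_mult)
    show ?thesis
      unfolding normal_density_def sq r K_def using e k by simp
  qed
  have "(\<integral>\<^sup>+l. ennreal (normal_density 0 a l) * ennreal (exp (l * u - l\<^sup>2 / 2 * h)) \<partial>lborel)
      = (\<integral>\<^sup>+l. ennreal K * ennreal (?d l) \<partial>lborel)"
    using k by (intro nn_integral_cong) (simp add: ennreal_mult[symmetric] pt[unfolded K_def] K_def del: times_divide_eq_left times_divide_eq_right)
  also have "\<dots> = ennreal K * (\<integral>\<^sup>+l. ennreal (?d l) \<partial>lborel)"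
    by (rule nn_integral_cmult) measurable
  also have "(\<integral>\<^sup>+l. ennreal (?d l) \<partial>lborel) = 1"
    using a k by (subst nn_integral_eq_integral) auto
  finally show ?thesis by (simp add: K_def k_def)
qed

section \<open>The mixing law and a lower bound for the mixture\<close>

text \<open>The pair is (\<theta>, l). \<open>normal_density\<close> takes a standard deviation, so
  l has variance \<open>a\<^sup>2\<close>.\<close>

definition mixing_measure :: "real \<Rightarrow> ('a::euclidean_space \<times> real) measure" where
  "mixing_measure a =
     uniform_measure lborel (cball 0 1) \<Otimes>\<^sub>M density lborel (\<lambda>l. ennreal (normal_density 0 a l))"

lemma sets_mixing_measure [measurable_cong, simp]:
  "sets (mixing_measure a) = sets (borel \<Otimes>\<^sub>M borel)"
  unfolding mixing_measure_def by (intro sets_pair_measure_cong) auto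

lemma prob_space_uniform_cball:
  "prob_space (uniform_measure lborel (cball (0::'a::euclidean_space) 1))"
  using unit_ball_vol_pos[of "real DIM('a)"]
  by (intro prob_space_uniform_measure) (simp_all add: emeasure_cball del: unit_ball_vol_pos)

lemma pair_prob_space_mixing:
  assumes "a > 0"
  shows "pair_prob_space (uniform_measure lborel (cball (0::'a::euclidean_space) 1))
    (density lborel (\<lambda>l. ennreal (normal_density 0 a l)))"
  using prob_space_uniform_cball prob_space_normal_density[OF assms, of 0]
  by (auto simp: pair_prob_space_def pair_sigma_finite_def intro: prob_space_imp_sigma_finite)

lemma prob_space_mixing_measure:
  assumes "a > 0"
  shows "prob_space (mixing_measure a :: ('a::euclidean_space \<times> real) measure)"
proof -
  interpret pair_prob_space "uniform_measure lborel (cball (0::'a) 1)"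
    "density lborel (\<lambda>l. ennreal (normal_density 0 a l))"
    by (rule pair_prob_space_mixing[OF assms])
  show ?thesis unfolding mixing_measure_def by (rule P.prob_space_axioms)
qed

text \<open>Three reductions at fixed \<open>l\<close>: restricting to a small ball costs its
  relative volume, the quadratic penalty is replaced by its largest value on the unit ball, and
  Jensen's inequality evaluates the linear exponential at the centre. All three work for either sign
  of \<open>l\<close>, as integration against a normal law requires.\<close>

lemma nn_integral_uniform_cball_ge:
  fixes s :: "'a::euclidean_space"
  assumes eps: "0 < \<epsilon>" "\<epsilon> < 1" and h: "h \<ge> 0"
  shows "ennreal (\<epsilon> ^ DIM('a)) * ennreal (exp (l * ((1 - \<epsilon>) * norm s) - l\<^sup>2 / 2 * h))
    \<le> (\<integral>\<^sup>+\<theta>. ennreal (exp (l * (\<theta> \<bullet> s) - l\<^sup>2 / 2 * h * (norm \<theta>)\<^sup>2))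
          \<partial>uniform_measure lborel (cball 0 1))"
proof -
  \<comment> \<open>For nonzero \<open>s\<close> this places the ball of radius \<epsilon> inside
    the unit ball, touching its boundary in the direction of \<open>s\<close>. For
    \<open>s = 0\<close>, \<open>sgn s\<close> is 0 and the ball is centred at the origin.\<close>
  define c where "c = (1 - \<epsilon>) *\<^sub>R sgn s"
  let ?q = "exp (- (l\<^sup>2 / 2 * h))"
  let ?B = "cball 0 1 :: 'a set"
  have cs: "s \<bullet> c = (1 - \<epsilon>) * norm s"
    by (cases "s = 0") (simp_all add: c_def sgn_div_norm dot_square_norm power2_eq_square)
  have nc: "norm c \<le> 1 - \<epsilon>"
    using eps by (simp add: c_def norm_sgn)
  have [measurable]: "cball c \<epsilon> \<in> sets borel" "?B \<in> sets borel"
    by (auto intro!: borel_closed)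
  have sub: "cball c \<epsilon> \<subseteq> ?B"
  proof
    fix x assume "x \<in> cball c \<epsilon>"
    then have "norm (x - c) \<le> \<epsilon>" by (simp add: dist_norm norm_minus_commute)
    then show "x \<in> ?B" using nc norm_triangle_sub[of x c] by simp
  qed
  have vol: "emeasure lborel (cball c \<epsilon>) / emeasure lborel ?B = ennreal (\<epsilon> ^ DIM('a))"
    using eps unit_ball_vol_pos[of "real DIM('a)"]
    by (simp add: emeasure_cball divide_ennreal del: unit_ball_vol_pos)
  have "ennreal (exp (l * ((1 - \<epsilon>) * norm s) - l\<^sup>2 / 2 * h)) * emeasure lborel (cball c \<epsilon>)
      = ennreal ?q * (ennreal (exp ((l *\<^sub>R s) \<bullet> c)) * emeasure lborel (cball c \<epsilon>))"
    by (simp add: cs mult.assoc[symmetric] ennreal_mult[symmetric] exp_add[symmetric])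
  also have "\<dots> \<le> ennreal ?q *
      (\<integral>\<^sup>+\<theta>. ennreal (exp ((l *\<^sub>R s) \<bullet> \<theta>)) * indicator (cball c \<epsilon>) \<theta> \<partial>lborel)"
    by (intro mult_left_mono nn_integral_exp_inner_cball_ge) simp
  also have "\<dots> = (\<integral>\<^sup>+\<theta>. ennreal ?q *
      (ennreal (exp ((l *\<^sub>R s) \<bullet> \<theta>)) * indicator (cball c \<epsilon>) \<theta>) \<partial>lborel)"
    by (rule nn_integral_cmult[symmetric]) measurable
  also have "\<dots> \<le> (\<integral>\<^sup>+\<theta>. ennreal (exp (l * (\<theta> \<bullet> s) - l\<^sup>2 / 2 * h * (norm \<theta>)\<^sup>2))
      * indicator ?B \<theta> \<partial>lborel)"
  proof (intro nn_integral_mono)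
    fix \<theta> :: 'a
    show "ennreal ?q * (ennreal (exp ((l *\<^sub>R s) \<bullet> \<theta>)) * indicator (cball c \<epsilon>) \<theta>)
      \<le> ennreal (exp (l * (\<theta> \<bullet> s) - l\<^sup>2 / 2 * h * (norm \<theta>)\<^sup>2)) * indicator ?B \<theta>"
    proof (cases "\<theta> \<in> cball c \<epsilon>")
      case True
      with sub have B: "\<theta> \<in> ?B" by blast
      then have "(norm \<theta>)\<^sup>2 \<le> 1" by (simp add: power_le_one)
      then have "l\<^sup>2 / 2 * h * (norm \<theta>)\<^sup>2 \<le> l\<^sup>2 / 2 * h * 1"
        using h by (intro mult_left_mono) auto
      then show ?thesis using True B
        by (simp add: ennreal_mult[symmetric] exp_add[symmetric] inner_commute)
    qed simp
  qed
  finally have "ennreal (exp (l * ((1 - \<epsilon>) * norm s) - l\<^sup>2 / 2 * h)) * emeasure lborel (cball c \<epsilon>)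
      / emeasure lborel ?B
    \<le> (\<integral>\<^sup>+\<theta>. ennreal (exp (l * (\<theta> \<bullet> s) - l\<^sup>2 / 2 * h * (norm \<theta>)\<^sup>2))
      * indicator ?B \<theta> \<partial>lborel) / emeasure lborel ?B"
    by (rule divide_right_mono_ennreal)
  also have "\<dots> = (\<integral>\<^sup>+\<theta>. ennreal (exp (l * (\<theta> \<bullet> s) - l\<^sup>2 / 2 * h * (norm \<theta>)\<^sup>2))
      \<partial>uniform_measure lborel ?B)"
    by (rule nn_integral_uniform_measure[symmetric]) measurable
  finally show ?thesis
    unfolding ennreal_times_divide[symmetric] vol by (simp only: mult.commute)
qed

text \<open>Integrating over \<theta> first, at fixed \<open>l\<close>, leaves the Gaussian integral
  with \<open>u = (1 - \<epsilon>) * norm s\<close>.\<close>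

lemma nn_integral_mixing_measure_ge:
  fixes s :: "'a::euclidean_space"
  assumes a: "a > 0" and eps: "0 < \<epsilon>" "\<epsilon> < 1" and h: "h \<ge> 0"
  shows "ennreal (\<epsilon> ^ DIM('a) *
      (exp (a\<^sup>2 * ((1 - \<epsilon>) * norm s)\<^sup>2 / (2 * (1 + a\<^sup>2 * h))) / sqrt (1 + a\<^sup>2 * h)))
    \<le> (\<integral>\<^sup>+p. ennreal (exp (snd p * (fst p \<bullet> s) - (snd p)\<^sup>2 / 2 * h * (norm (fst p))\<^sup>2))
          \<partial>mixing_measure a)"
proof -
  let ?U = "uniform_measure lborel (cball (0::'a) 1)"
  let ?G = "density lborel (\<lambda>l. ennreal (normal_density 0 a l))"
  let ?f = "\<lambda>p::'a \<times> real. ennreal (exp (snd p * (fst p \<bullet> s) - (snd p)\<^sup>2 / 2 * h * (norm (fst p))\<^sup>2))"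
  let ?g = "\<lambda>l. ennreal (exp (l * ((1 - \<epsilon>) * norm s) - l\<^sup>2 / 2 * h))"
  interpret pair_prob_space ?U ?G
    by (rule pair_prob_space_mixing[OF a])
  have f: "?f \<in> borel_measurable (?U \<Otimes>\<^sub>M ?G)"
    by measurable
  have "ennreal (\<epsilon> ^ DIM('a) *
      (exp (a\<^sup>2 * ((1 - \<epsilon>) * norm s)\<^sup>2 / (2 * (1 + a\<^sup>2 * h))) / sqrt (1 + a\<^sup>2 * h)))
      = ennreal (\<epsilon> ^ DIM('a)) * (\<integral>\<^sup>+l. ?g l \<partial>?G)"
    using eps h
    by (subst nn_integral_density)
       (simp_all add: nn_integral_exp_quadratic_normal[OF a h] ennreal_mult
         del: times_divide_eq_left times_divide_eq_right)
  also have "\<dots> = (\<integral>\<^sup>+l. ennreal (\<epsilon> ^ DIM('a)) * ?g l \<partial>?G)"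
    by (rule nn_integral_cmult[symmetric]) measurable
  also have "\<dots> \<le> (\<integral>\<^sup>+l. \<integral>\<^sup>+\<theta>. ?f (\<theta>, l) \<partial>?U \<partial>?G)"
    using nn_integral_uniform_cball_ge[OF eps h, of _ s] by (intro nn_integral_mono) simp
  also have "\<dots> = (\<integral>\<^sup>+p. ?f p \<partial>mixing_measure a)"
    unfolding mixing_measure_def by (rule nn_integral_snd[OF f])
  finally show ?thesis .
qed

section \<open>Adaptedness and the one-step supermartingale bound\<close>

lemma sets_natural_filtration_mono:
  assumes "m \<le> n"
  shows "sets (natural_filtration M X m) \<subseteq> sets (natural_filtration M X n)"
  unfolding sets_natural_filtration using assms by (intro sigma_sets_mono') fastforce

lemma measurable_natural_filtration_mono:
  assumes "f \<in> measurable (natural_filtration M X m) N" "m \<le> n"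
  shows "f \<in> measurable (natural_filtration M X n) N"
  by (rule measurable_from_subalg[OF _ assms(1)])
     (simp add: subalgebra_def sets_natural_filtration_mono[OF assms(2)])

lemma measurable_natural_filtration:
  assumes "1 \<le> i" "i \<le> n"
  shows "X i \<in> borel_measurable (natural_filtration M X n)"
proof (rule measurableI)
  fix A :: "'b set" assume "A \<in> sets borel"
  then show "X i -` A \<inter> space (natural_filtration M X n) \<in> sets (natural_filtration M X n)"
    unfolding sets_natural_filtration using assms by (auto intro!: sigma_sets.Basic)
qed simp

text \<open>A nonnegative weight \<open>Z\<close> known at time \<open>n\<close> can be moved past
  the conditional expectation, where the remaining factor is at most 1 almost everywhere. The
  penalty in \<open>\<sigma> (Suc n)\<close>, which is revealed only at time \<open>Suc n\<close>,
  stays inside with the increment.\<close>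

lemma conditionally_sub_gaussian_step:
  fixes X :: "nat \<Rightarrow> 'w \<Rightarrow> 'a::euclidean_space"
  assumes "prob_space M"
    and X: "\<And>t. t \<ge> 1 \<Longrightarrow> X t \<in> borel_measurable M"
    and \<mu>: "\<mu> (Suc n) \<in> borel_measurable M"
    and sg: "conditionally_sub_gaussian M X \<mu> \<sigma>"
    and Z: "Z \<in> borel_measurable (natural_filtration M X n)"
  shows "(\<integral>\<^sup>+\<omega>. Z \<omega> * ennreal (exp (l * (\<theta> \<bullet> (X (Suc n) \<omega> - \<mu> (Suc n) \<omega>))
      - l\<^sup>2 / 2 * (\<sigma> (Suc n) \<omega>)\<^sup>2 * (norm \<theta>)\<^sup>2)) \<partial>M) \<le> (\<integral>\<^sup>+\<omega>. Z \<omega> \<partial>M)"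
    (is "(\<integral>\<^sup>+\<omega>. Z \<omega> * ?\<xi> \<omega> \<partial>M) \<le> _")
proof -
  interpret prob_space M by fact
  have sub: "subalgebra M (natural_filtration M X k)" for k
    by (rule subalgebra_natural_filtration) (rule X)
  interpret finite_measure_subalgebra M "natural_filtration M X n"
    by unfold_locales (rule sub)
  have "1 \<le> Suc n" by simp
  with sg have \<sigma>: "\<sigma> (Suc n) \<in> borel_measurable (natural_filtration M X (Suc n))"
    and "AE \<omega> in M. nn_cond_exp M (natural_filtration M X (Suc n - 1)) ?\<xi> \<omega> \<le> 1"
    unfolding conditionally_sub_gaussian_def by blast+
  then have cond: "AE \<omega> in M. nn_cond_exp M (natural_filtration M X n) ?\<xi> \<omega> \<le> 1"
    by simp
  have [measurable]: "\<sigma> (Suc n) \<in> borel_measurable M"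
    by (rule measurable_from_subalg[OF sub \<sigma>])
  have [measurable]: "X (Suc n) \<in> borel_measurable M" by (rule X) simp
  note \<mu>[measurable]
  have "(\<integral>\<^sup>+\<omega>. Z \<omega> * ?\<xi> \<omega> \<partial>M)
      = (\<integral>\<^sup>+\<omega>. Z \<omega> * nn_cond_exp M (natural_filtration M X n) ?\<xi> \<omega> \<partial>M)"
    by (rule nn_cond_exp_intg[symmetric]) (use Z in measurable)
  also have "\<dots> \<le> (\<integral>\<^sup>+\<omega>. Z \<omega> \<partial>M)"
  proof (rule nn_integral_mono_AE)
    from cond show "AE \<omega> in M. Z \<omega> * nn_cond_exp M (natural_filtration M X n) ?\<xi> \<omega> \<le> Z \<omega>"
      by eventually_elim (rule order_trans[OF mult_left_mono[where b=1]], simp_all)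
  qed
  finally show ?thesis .
qed

section \<open>The time-uniform confidence bound\<close>

theorem theorem2p16:
  fixes M :: "'w measure"
    and X \<mu> :: "nat \<Rightarrow> 'w \<Rightarrow> 'a::euclidean_space"
    and \<sigma> H :: "nat \<Rightarrow> 'w \<Rightarrow> real"
    and a \<epsilon> \<alpha> :: real
  assumes "prob_space M"
    and "\<And>t. t \<ge> 1 \<Longrightarrow> integrable M (X t)"
    and "conditional_means M X \<mu>"
    and "conditionally_sub_gaussian M X \<mu> \<sigma>"
    and "\<And>t \<omega>. H t \<omega> = (\<Sum>i=1..t. (\<sigma> i \<omega>)\<^sup>2)"
    and "a > 0" and "0 < \<epsilon>" and "\<epsilon> < 1" and "0 < \<alpha>" and "\<alpha> < 1"
  shows "measure M {\<omega> \<in> space M. \<forall>t\<ge>1.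
           norm ((1 / real t) *\<^sub>R (\<Sum>i=1..t. X i \<omega> - \<mu> i \<omega>))
             \<le> 1 / (1 - \<epsilon>) *
                sqrt (2 * (1 + a\<^sup>2 * H t \<omega>) / (a\<^sup>2 * (real t)\<^sup>2) *
                  (real DIM('a) * ln (1 / \<epsilon>) + ln (sqrt (1 + a\<^sup>2 * H t \<omega>) / \<alpha>)))}
         \<ge> 1 - \<alpha>"
proof -
  interpret prob_space M by fact
  let ?F = "natural_filtration M X"
  let ?N = "mixing_measure a :: ('a \<times> real) measure"
  define S where "S n \<omega> = (\<Sum>i=1..n. X i \<omega> - \<mu> i \<omega>)" for n \<omega>
  define L where "L n p \<omega> = ennreal (exp (snd p * (fst p \<bullet> S n \<omega>)
      - (snd p)\<^sup>2 / 2 * H n \<omega> * (norm (fst p))\<^sup>2))" for n \<omega> and p :: "'a \<times> real"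
  \<comment> \<open>The law of \<open>p\<close> depends on neither time nor data, so averaging
    preserves the supermartingale property.\<close>
  define W where "W n \<omega> = (\<integral>\<^sup>+p. L n p \<omega> \<partial>?N)" for n \<omega>
  interpret N: prob_space ?N
    by (rule prob_space_mixing_measure) fact
  interpret MN: pair_sigma_finite M ?N ..
  have X: "X t \<in> borel_measurable M" if "t \<ge> 1" for t
    using assms(2)[OF that] by simp
  have sub: "subalgebra M (?F n)" for n
    by (rule subalgebra_natural_filtration) (rule X)
  have \<mu>F: "\<mu> i \<in> borel_measurable (?F n)" if "1 \<le> i" "i \<le> n" for i n
    using assms(3) that measurable_natural_filtration_mono[of "\<mu> i" M X "i - 1" borel n]
    unfolding conditional_means_def by auto
  have \<sigma>F: "\<sigma> i \<in> borel_measurable (?F n)" if "1 \<le> i" "i \<le> n" for i n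
    using assms(4) that measurable_natural_filtration_mono[of "\<sigma> i" M X i borel n]
    unfolding conditionally_sub_gaussian_def by auto
  have SF[measurable]: "S n \<in> borel_measurable (?F n)" for n
    unfolding S_def
    by (intro borel_measurable_sum borel_measurable_diff)
       (auto intro: measurable_natural_filtration \<mu>F)
  have HF[measurable]: "H n \<in> borel_measurable (?F n)" for n
    unfolding assms(5)[abs_def]
    by (intro borel_measurable_sum borel_measurable_power) (auto intro: \<sigma>F)
  have SM[measurable]: "S n \<in> borel_measurable M" and HM[measurable]: "H n \<in> borel_measurable M" for n
    using measurable_from_subalg[OF sub SF] measurable_from_subalg[OF sub HF] by auto
  have H0: "0 \<le> H n \<omega>" for n \<omega>
    unfolding assms(5) by (intro sum_nonneg) simp
  have LF: "L n p \<in> borel_measurable (?F n)" for n p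
    unfolding L_def by measurable
  \<comment> \<open>Joint measurability over \<open>?F n\<close> makes \<open>W n\<close> adapted;
    over \<open>M\<close> it permits the exchange of integrals.\<close>
  have LFN: "(\<lambda>(\<omega>, p). L n p \<omega>) \<in> borel_measurable (?F n \<Otimes>\<^sub>M ?N)" for n
    unfolding L_def by measurable
  have LMN[measurable]: "(\<lambda>(\<omega>, p). L n p \<omega>) \<in> borel_measurable (M \<Otimes>\<^sub>M ?N)" for n
    unfolding L_def by measurable
  have WF: "W n \<in> borel_measurable (?F n)" for n
    unfolding W_def using LFN by (rule N.borel_measurable_nn_integral)
  have step: "(\<integral>\<^sup>+\<omega>. L (Suc n) p \<omega> * indicator A \<omega> \<partial>M) \<le> (\<integral>\<^sup>+\<omega>. L n p \<omega> * indicator A \<omega> \<partial>M)"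
    if A: "A \<in> sets (?F n)" for n p A
  proof -
    \<comment> \<open>The current value and the event are both known at time \<open>n\<close>; the
      next value is \<open>L n p\<close> times the factor controlled by the one-step bound.\<close>
    let ?Z = "\<lambda>\<omega>. L n p \<omega> * indicator A \<omega>"
    have Z: "?Z \<in> borel_measurable (?F n)"
      using LF A by measurable
    have "\<mu> (Suc n) \<in> borel_measurable M"
      by (rule measurable_from_subalg[OF sub \<mu>F]) auto
    note * = conditionally_sub_gaussian_step[OF assms(1) X this assms(4) Z, of "snd p" "fst p"]
    have "L (Suc n) p \<omega> = L n p \<omega> * ennreal (exp (snd p * (fst p \<bullet> (X (Suc n) \<omega> - \<mu> (Suc n) \<omega>))
        - (snd p)\<^sup>2 / 2 * (\<sigma> (Suc n) \<omega>)\<^sup>2 * (norm (fst p))\<^sup>2))" for \<omega>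
    proof -
      have S: "S (Suc n) \<omega> = S n \<omega> + (X (Suc n) \<omega> - \<mu> (Suc n) \<omega>)"
        and H: "H (Suc n) \<omega> = H n \<omega> + (\<sigma> (Suc n) \<omega>)\<^sup>2"
        by (simp_all add: S_def assms(5))
      show ?thesis
        unfolding L_def S H ennreal_mult[OF exp_ge_zero exp_ge_zero, symmetric] exp_add[symmetric]
        by (simp only: inner_add_right distrib_left distrib_right add_diff_add)
    qed
    with * show ?thesis
      by (simp only: mult_ac)
  qed
  have super: "(\<integral>\<^sup>+\<omega>. W (Suc n) \<omega> * indicator A \<omega> \<partial>M) \<le> (\<integral>\<^sup>+\<omega>. W n \<omega> * indicator A \<omega> \<partial>M)"
    if A: "A \<in> sets (?F n)" for n A
  proof -
    have AM[measurable]: "A \<in> sets M"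
      using A sub[of n] by (auto simp: subalgebra_def)
    \<comment> \<open>With the integral over \<open>p\<close> outermost, the inequality for each
      fixed \<open>p\<close> can be integrated.\<close>
    have W: "(\<integral>\<^sup>+\<omega>. W k \<omega> * indicator A \<omega> \<partial>M)
        = (\<integral>\<^sup>+p. \<integral>\<^sup>+\<omega>. L k p \<omega> * indicator A \<omega> \<partial>M \<partial>?N)" for k
    proof -
      have "(\<integral>\<^sup>+\<omega>. W k \<omega> * indicator A \<omega> \<partial>M)
          = (\<integral>\<^sup>+\<omega>. \<integral>\<^sup>+p. L k p \<omega> * indicator A \<omega> \<partial>?N \<partial>M)"
        unfolding W_def
        by (intro nn_integral_cong nn_integral_multc[symmetric]) (simp add: L_def)
      also have "\<dots> = (\<integral>\<^sup>+p. \<integral>\<^sup>+\<omega>. L k p \<omega> * indicator A \<omega> \<partial>M \<partial>?N)"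
        by (rule MN.Fubini'[symmetric]) measurable
      finally show ?thesis .
    qed
    show ?thesis
      unfolding W by (intro nn_integral_mono step A)
  qed
  define bad where "bad = {\<omega> \<in> space M. \<exists>n. ennreal (1 / \<alpha>) \<le> W n \<omega>}"
  have bad[measurable]: "bad \<in> sets M"
  proof -
    have [measurable]: "W n \<in> borel_measurable M" for n
      using measurable_from_subalg[OF sub WF] .
    show ?thesis unfolding bad_def by measurable
  qed
  have "ennreal (1 / \<alpha>) * emeasure M bad \<le> (\<integral>\<^sup>+\<omega>. W 0 \<omega> \<partial>M)"
    unfolding bad_def
    by (rule ville_inequality[where F = ?F])
       (auto intro: sub WF super sets_natural_filtration_mono[THEN subsetD, rotated])
  \<comment> \<open>At time 0 both sums are empty, so \<open>L 0 p\<close> is 1 for every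
    \<open>p\<close>, and both measures have total mass 1.\<close>
  also have "\<dots> = 1"
    by (simp add: W_def L_def S_def assms(5) N.emeasure_space_1 emeasure_space_1)
  finally have "ennreal (1 / \<alpha> * prob bad) \<le> ennreal 1"
    using assms(9) by (simp add: emeasure_eq_measure ennreal_mult del: times_divide_eq_left)
  then have pbad: "prob bad \<le> \<alpha>"
    using assms(9) by (simp only: ennreal_le_iff zero_le_one) (simp add: field_simps)
  define R where "R t \<omega> = 1 / (1 - \<epsilon>) *
      sqrt (2 * (1 + a\<^sup>2 * H t \<omega>) / (a\<^sup>2 * (real t)\<^sup>2) *
        (real DIM('a) * ln (1 / \<epsilon>) + ln (sqrt (1 + a\<^sup>2 * H t \<omega>) / \<alpha>)))" for t \<omega>
  have [measurable]: "R t \<in> borel_measurable M" for t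
    unfolding R_def by measurable
  let ?good = "{\<omega> \<in> space M. \<forall>t\<ge>1. norm ((1 / real t) *\<^sub>R S t \<omega>) \<le> R t \<omega>}"
  have good: "?good \<in> sets M"
    by measurable
  have "space M - bad \<subseteq> ?good"
  proof (intro subsetI CollectI conjI allI impI)
    show "\<omega> \<in> space M" if "\<omega> \<in> space M - bad" for \<omega>
      using that by simp
  next
    fix \<omega> and t :: nat
    assume \<omega>: "\<omega> \<in> space M - bad" and t: "1 \<le> t"
    define k where "k = 1 + a\<^sup>2 * H t \<omega>"
    define s where "s = norm (S t \<omega>)"
    define D where "D = real DIM('a) * ln (1 / \<epsilon>) + ln (sqrt k / \<alpha>)"
    have k: "k > 0" using H0[of t \<omega>] by (simp add: k_def add_pos_nonneg)
    \<comment> \<open>The outcome is fixed here, so the small ball may be aimed along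
      \<open>S t \<omega>\<close>; this data-dependent choice enters only a lower bound for
      \<open>W\<close>, not its definition.\<close>
    have "ennreal (\<epsilon> ^ DIM('a) * (exp (a\<^sup>2 * ((1 - \<epsilon>) * s)\<^sup>2 / (2 * k)) / sqrt k)) \<le> W t \<omega>"
      unfolding W_def L_def s_def k_def
      by (rule nn_integral_mixing_measure_ge) (use assms H0 in auto)
    also have "\<dots> < ennreal (1 / \<alpha>)"
      using \<omega> by (auto simp: bad_def not_le)
    finally have "\<epsilon> ^ DIM('a) * (exp (a\<^sup>2 * ((1 - \<epsilon>) * s)\<^sup>2 / (2 * k)) / sqrt k) < 1 / \<alpha>"
      using assms k by (simp add: ennreal_less_iff)
    then have "exp (a\<^sup>2 * ((1 - \<epsilon>) * s)\<^sup>2 / (2 * k)) < (1 / \<epsilon>) ^ DIM('a) * (sqrt k / \<alpha>)"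
      using assms k by (simp add: field_simps)
    \<comment> \<open>The two terms of \<open>D\<close> are the logarithms of the inverse volume
      ratio and of the Gaussian factor \<open>sqrt k\<close> combined with the level
      \<open>1 / \<alpha>\<close>.\<close>
    also have "\<dots> = exp D"
      using assms k by (simp add: D_def exp_add exp_of_nat_mult)
    finally have "a\<^sup>2 * ((1 - \<epsilon>) * s)\<^sup>2 / (2 * k) < D"
      by simp
    \<comment> \<open>Dividing by \<open>t\<^sup>2\<close> turns the sum into the average. The
      shrinkage \<open>1 - \<epsilon>\<close> of the centre becomes the prefactor of the bound after
      taking roots.\<close>
    then have "((1 - \<epsilon>) * (s / t))\<^sup>2 \<le> 2 * k / (a\<^sup>2 * (real t)\<^sup>2) * D"
      using assms k t by (simp add: field_simps power_mult_distrib)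
    then have "(1 - \<epsilon>) * (s / t) \<le> sqrt (2 * k / (a\<^sup>2 * (real t)\<^sup>2) * D)"
      by (rule real_le_rsqrt)
    then have "s / t \<le> 1 / (1 - \<epsilon>) * sqrt (2 * k / (a\<^sup>2 * (real t)\<^sup>2) * D)"
      using assms by (simp add: field_simps)
    then show "norm ((1 / real t) *\<^sub>R S t \<omega>) \<le> R t \<omega>"
      by (simp add: R_def s_def k_def D_def)
  qed
  then have "prob (space M - bad) \<le> prob ?good"
    by (rule finite_measure_mono[OF _ good])
  with pbad prob_compl[OF bad] have "1 - \<alpha> \<le> prob ?good"
    by linarith
  then show ?thesis
    unfolding S_def R_def .
qed

end
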